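(* For every positive integer $n$, the triples of statistics $(S_{10},S_{12},S_{17})$ and $(S_{12},S_{10},S_{17})$ are equidistributed over the symmetric group $\mathfrak S_n$; that is, for all integers $a,b,c$, $$\#\{p\in\mathfrak S_n:(S_{10},S_{12},S_{17})(p)=(a,b,c)\}=\#\{p\in\mathfrak S_n:(S_{12},S_{10},S_{17})(p)=(a,b,c)\}.$$
   Context: For $p=p_1p_2\cdots p_n\in\mathfrak S_n$ in one-line notation, with $\mathbb O$ the set of odd positive integers: $S_{10}(p)=|\{i\in[n-1]:p_i>p_{i+1}\text{ and }p_i\in\mathbb O\}|$; $S_{12}(p)=|\{i\in[n-1]:p_i,p_{i+1}\in\mathbb O\}|$; $S_{17}(p)$ is the largest $i\in[n]$ such that the elements $1,2,\dots,i$ appear in this order from left to right in $p$. *)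

theory Defs
  imports "HOL-Combinatorics.Permutations"
begin

text \<open>
  The symmetric group on \<open>[n]\<close> is \<open>{p. p permutes {1..n}}\<close>; the one-line notation of \<open>p\<close> is
  \<open>p 1, p 2, \<dots>, p n\<close>, with positions and values both starting at 1.
\<close>

definition S10 :: "nat \<Rightarrow> (nat \<Rightarrow> nat) \<Rightarrow> nat" where
  "S10 n p = card {i \<in> {1..n - 1}. p i > p (i + 1) \<and> odd (p i)}"

definition S12 :: "nat \<Rightarrow> (nat \<Rightarrow> nat) \<Rightarrow> nat" where
  "S12 n p = card {i \<in> {1..n - 1}. odd (p i) \<and> odd (p (i + 1))}"

text \<open>
  The position of the value \<open>j\<close> in the one-line notation of \<open>p\<close> is \<open>inv p j\<close>, so \<open>1, \<dots>, i\<close> appear in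
  this order from left to right iff \<open>inv p\<close> is strictly increasing on \<open>{1..i}\<close>. For \<open>n \<ge> 1\<close> the
  set below is finite and contains 1.
\<close>

definition S17 :: "nat \<Rightarrow> (nat \<Rightarrow> nat) \<Rightarrow> nat" where
  "S17 n p = Max {i \<in> {1..n}. strict_mono_on {1..i} (inv p)}"

end

theory Submission
  imports Defs "HOL-Combinatorics.Multiset_Permutations"
begin

text \<open>
  Grow permutations by inserting \<open>n + 1\<close> into words on \<open>{1..n}\<close>. To a word attach the state
  \<open>(a, b, c, e)\<close>: \<open>a\<close> and \<open>b\<close> are the values of \<open>S10\<close> and \<open>S12\<close>, \<open>c\<close> counts the adjacencies
  contributing to both, and \<open>e\<close> says whether the last letter is odd. Counting odd letters once by
  their predecessors and once by their successors shows that the multiset of states of the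
  \<open>n + 1\<close> children of a word depends only on \<open>n\<close> and its state, and that this dependence commutes
  with exchanging \<open>a\<close> and \<open>b\<close>. The permutations with \<open>S17 \<ge> i\<close> are exactly the descendants of the
  word \<open>1 2 \<dots> i\<close>, whose state has \<open>a = b = 0\<close>; hence \<open>S10\<close> and \<open>S12\<close> can be exchanged on each
  such set, and therefore also on the differences \<open>S17 = i\<close>.
\<close>

section \<open>Words, their adjacencies, and insertion of a letter\<close>

fun adj_count :: "('a \<Rightarrow> 'a \<Rightarrow> bool) \<Rightarrow> 'a list \<Rightarrow> nat" where
  "adj_count P (x # y # zs) = (if P x y then 1 else 0) + adj_count P (y # zs)"
| "adj_count P _ = 0"

fun insertions :: "'a \<Rightarrow> 'a list \<Rightarrow> 'a list list" where
  "insertions v [] = [[v]]"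
| "insertions v (x # xs) = (v # x # xs) # map ((#) x) (insertions v xs)"

lemma set_insertions: "set (insertions v w) = {xs @ v # ys | xs ys. w = xs @ ys}"
proof (induction w)
  case (Cons x w)
  have "{xs @ v # ys | xs ys. x # w = xs @ ys}
      = insert (v # x # w) ((#) x ` {xs @ v # ys | xs ys. w = xs @ ys})"
    (is "?A = insert _ ?B")
  proof (intro equalityI subsetI)
    fix u assume "u \<in> insert (v # x # w) ?B"
    then consider "u = [] @ v # x # w" | xs ys where "w = xs @ ys" "u = (x # xs) @ v # ys"
      by auto
    then show "u \<in> ?A" by cases (blast, metis (mono_tags, lifting) CollectI append_Cons)
  next
    fix u assume "u \<in> ?A"
    then obtain xs ys where "x # w = xs @ ys" "u = xs @ v # ys" by blast
    then show "u \<in> insert (v # x # w) ?B" by (cases xs) auto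
  qed
  then show ?case using Cons.IH by simp
qed auto

lemma removeAll_insertions:
  assumes "v \<notin> set w" "u \<in> set (insertions v w)"
  shows "removeAll v u = w"
  using assms by (auto simp: set_insertions)

lemma distinct_insertions: "v \<notin> set w \<Longrightarrow> distinct (insertions v w)"
  by (induction w) (auto simp: distinct_map)

text \<open>Deleting \<open>v\<close> recovers \<open>w\<close> from each of its insertions, so the
  sets in the union are disjoint; the insertion lists are free of repetitions, so no multiplicities
  are lost.\<close>

lemma mset_set_UN_insertions:
  assumes "finite W" "\<And>w. w \<in> W \<Longrightarrow> v \<notin> set w"
  shows "mset_set (\<Union>w\<in>W. set (insertions v w)) = (\<Sum>w\<in>W. mset (insertions v w))"
  using assms
proof (induction W rule: finite_induct)
  case (insert w W)
  have "set (insertions v w) \<inter> (\<Union>w\<in>W. set (insertions v w)) = {}"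
  proof (rule ccontr)
    assume "\<not> ?thesis"
    then obtain u w' where "u \<in> set (insertions v w)" "w' \<in> W" "u \<in> set (insertions v w')"
      by blast
    then have "removeAll v u = w" "removeAll v u = w'"
      using insert.prems by (auto intro: removeAll_insertions)
    with \<open>w' \<in> W\<close> insert.hyps(2) show False by simp
  qed
  then show ?case
    using insert distinct_insertions[of v w]
    by (simp add: mset_set_Union mset_set_set)
qed simp

section \<open>Adjacencies classified by parity and order\<close>

abbreviation "desc_oo \<equiv> adj_count (\<lambda>x y::nat. y < x \<and> odd x \<and> odd y)"
abbreviation "desc_oe \<equiv> adj_count (\<lambda>x y::nat. y < x \<and> odd x \<and> even y)"
abbreviation "asc_oo \<equiv> adj_count (\<lambda>x y::nat. \<not> y < x \<and> odd x \<and> odd y)"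
abbreviation "asc_oe \<equiv> adj_count (\<lambda>x y::nat. \<not> y < x \<and> odd x \<and> even y)"
abbreviation "adj_eo \<equiv> adj_count (\<lambda>x y::nat. even x \<and> odd y)"
abbreviation "adj_ee \<equiv> adj_count (\<lambda>x y::nat. even x \<and> even y)"

text \<open>An odd letter is either first or preceded by an odd or an even letter.\<close>

lemma count_odd_by_predecessor:
  "w \<noteq> [] \<Longrightarrow> length (filter odd w) = desc_oo w + asc_oo w + adj_eo w + of_bool (odd (hd w))"
  by (induction w rule: induct_list012) auto

text \<open>An odd letter is either last or followed by an odd or an even letter.\<close>

lemma count_odd_by_successor:
  "w \<noteq> [] \<Longrightarrow> length (filter odd w)
     = desc_oo w + asc_oo w + desc_oe w + asc_oe w + of_bool (odd (last w))"
  by (induction w rule: induct_list012) auto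

lemma length_by_adjacencies:
  "w \<noteq> [] \<Longrightarrow> length w
     = Suc (desc_oo w + asc_oo w + desc_oe w + asc_oe w + adj_eo w + adj_ee w)"
  by (induction w rule: induct_list012) auto

section \<open>States of words and of their children\<close>

text \<open>Integers are used so that the decrements occurring in states of children are genuine
  subtractions, which commute with the translations in \<open>shift\<close>.\<close>

definition state :: "nat list \<Rightarrow> int \<times> int \<times> int \<times> bool" where
  "state w = (int (adj_count (\<lambda>x y. y < x \<and> odd x) w),
              int (adj_count (\<lambda>x y. odd x \<and> odd y) w),
              int (desc_oo w),
              odd (last w))"

lemma state_eq:
  "state w = (int (desc_oo w + desc_oe w), int (desc_oo w + asc_oo w), int (desc_oo w), odd (last w))"
proof -
  have "adj_count (\<lambda>x y. y < x \<and> odd x) w = desc_oo w + desc_oe w"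
    by (induction w rule: induct_list012) auto
  moreover have "adj_count (\<lambda>x y. odd x \<and> odd y) w = desc_oo w + asc_oo w"
    by (induction w rule: induct_list012) auto
  ultimately show ?thesis by (simp add: state_def)
qed

fun shift :: "nat \<Rightarrow> nat \<Rightarrow> int \<times> int \<times> int \<times> bool \<Rightarrow> int \<times> int \<times> int \<times> bool" where
  "shift x y (a, b, c, e) =
     (a + of_bool (y < x \<and> odd x), b + of_bool (odd x \<and> odd y),
      c + of_bool (y < x \<and> odd x \<and> odd y), e)"

lemma state_Cons: "state (x # y # w) = shift x y (state (y # w))"
  by (simp add: state_def)

fun swap_state :: "int \<times> int \<times> int \<times> bool \<Rightarrow> int \<times> int \<times> int \<times> bool" where
  "swap_state (a, b, c, e) = (b, a, c, e)"

text \<open>An even new maximum destroys the contributions of the adjacency it splits and creates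
  none; the fourth summand includes the front insertion, the last one is the end insertion. For an
  odd new maximum, the end insertion belongs to the third summand if \<open>e\<close> holds and is
  the last summand otherwise.\<close>

fun children :: "nat \<Rightarrow> int \<times> int \<times> int \<times> bool \<Rightarrow> (int \<times> int \<times> int \<times> bool) multiset" where
  "children n (a, b, c, e) =
    (if odd n then
       replicate_mset (nat c) (a - 1, b - 1, c - 1, e) +
       replicate_mset (nat (a - c)) (a - 1, b, c, e) +
       replicate_mset (nat (b - c)) (a, b - 1, c, e) +
       replicate_mset (nat (int n - a - b + c)) (a, b, c, e) +
       {#(a, b, c, False)#}
     else
       replicate_mset (nat (int n div 2 - c)) (a + 1, b + 1, c + 1, e) +
       replicate_mset (nat (int n div 2 - a - b + c - of_bool e)) (a + 1, b + 1, c, e) +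
       replicate_mset (nat (a + of_bool e)) (a, b + 1, c, e) +
       replicate_mset (nat (b + of_bool e)) (a + 1, b, c, e) +
       (if e then {#} else {#(a, b, c, True)#}))"

text \<open>One pair of summands is exchanged: the second and third for odd \<open>n\<close>, the
  third and fourth for even \<open>n\<close>. The other multiplicities are symmetric in
  \<open>a\<close> and \<open>b\<close>.\<close>

lemma children_swap_state: "children n (swap_state s) = image_mset swap_state (children n s)"
  by (cases s) (simp add: algebra_simps add_mset_commute)

text \<open>The letter \<open>v\<close> goes either directly between \<open>x\<close> and
  \<open>y\<close> or somewhere after \<open>y\<close>; in the latter case the adjacency of
  \<open>x\<close> and \<open>y\<close> survives and only shifts the state.\<close>

lemma states_Cons_insertions:
  "image_mset state (mset (map ((#) x) (insertions v (y # w)))) =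
     add_mset (state (x # v # y # w))
       (image_mset (shift x y) (image_mset state (mset (map ((#) y) (insertions v w)))))"
  by (simp add: image_mset.compositionality o_def state_Cons)

text \<open>
  Insertion at the very front is left out here, because the induction prepends a letter.
\<close>

lemma states_inner_even:
  assumes "even v" "\<forall>y\<in>set (x # w). y < v" "state (x # w) = (a, b, c, e)"
  shows "image_mset state (mset (map ((#) x) (insertions v w))) =
     replicate_mset (desc_oo (x # w)) (a - 1, b - 1, c - 1, e) +
     replicate_mset (desc_oe (x # w)) (a - 1, b, c, e) +
     replicate_mset (asc_oo (x # w)) (a, b - 1, c, e) +
     replicate_mset (asc_oe (x # w) + adj_eo (x # w) + adj_ee (x # w)) (a, b, c, e) +
     {#(a, b, c, False)#}"
  using assms
proof (induction w arbitrary: x a b c e)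
  case Nil
  then show ?case by (auto simp: state_def)
next
  case (Cons y w)
  obtain a' b' c' e' where s: "state (y # w) = (a', b', c', e')" by (cases "state (y # w)")
  have IH: "image_mset state (mset (map ((#) y) (insertions v w))) =
     replicate_mset (desc_oo (y # w)) (a' - 1, b' - 1, c' - 1, e') +
     replicate_mset (desc_oe (y # w)) (a' - 1, b', c', e') +
     replicate_mset (asc_oo (y # w)) (a', b' - 1, c', e') +
     replicate_mset (asc_oe (y # w) + adj_eo (y # w) + adj_ee (y # w)) (a', b', c', e') +
     {#(a', b', c', False)#}"
    using Cons.prems s by (intro Cons.IH) auto
  have "(a, b, c, e) = shift x y (a', b', c', e')"
    using Cons.prems(3) s by (simp add: state_Cons)
  moreover have "x < v" "y < v" using Cons.prems by auto
  \<comment> \<open>The parities and the order of \<open>x\<close> and \<open>y\<close> decide which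
    summand receives the word that splits this adjacency.\<close>
  ultimately show ?case
    unfolding states_Cons_insertions IH state_Cons s using \<open>even v\<close>
    by (cases "odd x"; cases "odd y"; cases "y < x") (simp_all add: ac_simps)
qed

text \<open>An odd maximum always starts a descent counted by \<open>a\<close>, and it adds to
  \<open>b\<close> once for each odd neighbour, and to \<open>c\<close> if its right neighbour is
  odd. The contributions of the split adjacency are subtracted from this.\<close>

lemma states_inner_odd:
  assumes "odd v" "\<forall>y\<in>set (x # w). y < v" "state (x # w) = (a, b, c, e)"
  shows "image_mset state (mset (map ((#) x) (insertions v w))) =
     replicate_mset (asc_oo (x # w) + adj_eo (x # w)) (a + 1, b + 1, c + 1, e) +
     replicate_mset (asc_oe (x # w)) (a + 1, b + 1, c, e) +
     replicate_mset (desc_oo (x # w) + desc_oe (x # w)) (a, b + 1, c, e) +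
     replicate_mset (adj_ee (x # w)) (a + 1, b, c, e) +
     {#(a, b + of_bool e, c, True)#}"
  using assms
proof (induction w arbitrary: x a b c e)
  case Nil
  then show ?case by (auto simp: state_def)
next
  case (Cons y w)
  obtain a' b' c' e' where s: "state (y # w) = (a', b', c', e')" by (cases "state (y # w)")
  have IH: "image_mset state (mset (map ((#) y) (insertions v w))) =
     replicate_mset (asc_oo (y # w) + adj_eo (y # w)) (a' + 1, b' + 1, c' + 1, e') +
     replicate_mset (asc_oe (y # w)) (a' + 1, b' + 1, c', e') +
     replicate_mset (desc_oo (y # w) + desc_oe (y # w)) (a', b' + 1, c', e') +
     replicate_mset (adj_ee (y # w)) (a' + 1, b', c', e') +
     {#(a', b' + of_bool e', c', True)#}"
    using Cons.prems s by (intro Cons.IH) auto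
  have "(a, b, c, e) = shift x y (a', b', c', e')"
    using Cons.prems(3) s by (simp add: state_Cons)
  moreover have "x < v" "y < v" using Cons.prems by auto
  ultimately show ?case
    unfolding states_Cons_insertions IH state_Cons s using \<open>odd v\<close>
    by (cases "odd x"; cases "odd y"; cases "y < x") (simp_all add: ac_simps)
qed

lemma length_filter_odd:
  assumes "distinct w" "set w = {1..n}"
  shows "length (filter odd w) = (n + 1) div 2"
proof -
  have "length (filter odd w) = card {i \<in> {1..n}. odd i}"
    using assms by (metis distinct_card distinct_filter set_filter)
  also have "\<dots> = (n + 1) div 2"
  proof (induction n)
    case (Suc n)
    have "{i \<in> {1..Suc n}. odd i} = (if odd (Suc n) then insert (Suc n) else id) {i \<in> {1..n}. odd i}"
      by (auto simp: le_Suc_eq)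
    then show ?case using Suc by auto
  qed simp
  finally show ?thesis .
qed

text \<open>The front insertion is added to the inner ones, and the two counts of odd letters
  together with the length express all multiplicities through \<open>n\<close> and the
  state.\<close>

lemma states_insertions:
  assumes "distinct w" "set w = {1..n}" "n \<ge> 1"
  shows "image_mset state (mset (insertions (Suc n) w)) = children n (state w)"
proof -
  obtain x xs where w: "w = x # xs" using assms by (cases w) auto
  obtain a b c e where s: "state w = (a, b, c, e)" by (cases "state w")
  have len: "length w = n" using assms by (metis card_atLeastAtMost diff_Suc_1 distinct_card)
  have less: "\<forall>y\<in>set (x # xs). y < Suc n" using assms w by auto
  have abc: "a = int (desc_oo w + desc_oe w)" "b = int (desc_oo w + asc_oo w)" 
    "c = int (desc_oo w)" "e = odd (last w)"
    using s by (simp_all add: state_eq)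
  have wne: "w \<noteq> []" using w by simp
  note cnt = count_odd_by_predecessor[OF wne] count_odd_by_successor[OF wne] length_by_adjacencies[OF wne]
  note odds = length_filter_odd[OF assms(1,2)]
  have ins: "image_mset state (mset (insertions (Suc n) w)) = add_mset (shift (Suc n) x (a, b, c, e))
      (image_mset state (mset (map ((#) x) (insertions (Suc n) xs))))"
    using s w by (simp add: state_Cons)
  show ?thesis
  proof (cases "odd n")
    case True
    have "nat c = desc_oo w" "nat (a - c) = desc_oe w" "nat (b - c) = asc_oo w"
      by (simp_all add: abc)
    \<comment> \<open>The \<open>Suc\<close> accounts for the front insertion, which leaves the
      state unchanged.\<close>
    moreover have "nat (int n - a - b + c) = Suc (asc_oe w + adj_eo w + adj_ee w)"
      using cnt(3) len by (simp add: abc)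
    moreover have "shift (Suc n) x (a, b, c, e) = (a, b, c, e)"
      using True by simp
    ultimately show ?thesis
      unfolding ins s using states_inner_even[OF _ less s[unfolded w]] True
      by (simp flip: w add: ac_simps)
  next
    case False
    then obtain k where n: "n = 2 * k" by blast
    define o1 where "o1 = (of_bool (odd x) :: nat)"
    have k: "desc_oo w + asc_oo w + adj_eo w + o1 = k"
      "desc_oo w + asc_oo w + desc_oe w + asc_oe w + of_bool e = k"
      using cnt(1,2) odds n by (simp_all add: abc(4) w o1_def)
    have "nat (int n div 2 - c) = asc_oo w + adj_eo w + of_bool (odd x)"
       "nat (int n div 2 - a - b + c - of_bool e) = asc_oe w"
       "nat (a + of_bool e) = desc_oo w + desc_oe w + of_bool e"
      using k by (auto simp: abc(1-3) n o1_def)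
    \<comment> \<open>Equating the length \<open>2 * k\<close> with the sum of both expressions for
      \<open>k\<close> leaves \<open>adj_ee w\<close> in terms of \<open>b\<close>, \<open>e\<close>
      and the parity of \<open>x\<close>. This matches the multiplicity \<open>a + of_bool e\<close>
      under the swap.\<close>
    moreover have "nat (b + of_bool e) = adj_ee w + of_bool (even x)"
      using k cnt(3) len by (auto simp: abc(1-3) n o1_def)
    \<comment> \<open>The front insertion joins the first summand if \<open>x\<close> is odd and the
      fourth if \<open>x\<close> is even.\<close>
    moreover have "shift (Suc n) x (a, b, c, e) = (if odd x then (a+1,b+1,c+1,e) else (a+1,b,c,e))"
      using False less by simp
    ultimately show ?thesis
      unfolding ins s using states_inner_odd[OF _ less s[unfolded w]] False
      by (cases "odd x"; cases e) (simp_all flip: w add: ac_simps)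
  qed
qed

section \<open>Words containing \<open>1, ..., i\<close> in increasing order\<close>

definition words :: "nat \<Rightarrow> nat \<Rightarrow> nat list set" where
  "words i n = {w. distinct w \<and> set w = {1..n} \<and> filter (\<lambda>x. x \<le> i) w = [1..<Suc i]}"

lemma finite_words: "finite (words i n)"
  by (rule finite_subset[OF _ finite_permutations_of_set[of "{1..n}"]])
    (auto simp: words_def permutations_of_set_def)

lemma words_self: "words i i = {[1..<Suc i]}"
proof -
  have "filter (\<lambda>x. x \<le> i) w = w" if "set w = {1..i}" for w :: "nat list"
    using that by (intro filter_True) auto
  moreover have "filter (\<lambda>x. x \<le> i) [1..<Suc i] = [1..<Suc i]" by (intro filter_True) auto
  ultimately show ?thesis by (auto simp: words_def simp del: upt_Suc)
qed

text \<open>Inserting or deleting the letter \<open>Suc n\<close>, which exceeds \<open>i\<close>,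
  does not affect the filtered word.\<close>

lemma words_Suc:
  assumes "i \<le> n"
  shows "words i (Suc n) = (\<Union>w\<in>words i n. set (insertions (Suc n) w))"
proof (intro equalityI subsetI)
  fix u assume u: "u \<in> words i (Suc n)"
  then have set_u: "set u = {1..Suc n}" and dist: "distinct u"
    and filt: "filter (\<lambda>x. x \<le> i) u = [1..<Suc i]"
    unfolding words_def by blast+
  then have "Suc n \<in> set u" by simp
  then obtain xs ys where xy: "u = xs @ Suc n # ys" by (meson split_list)
  have "set (xs @ ys) = set u - {Suc n}" using dist by (simp add: xy)
  also have "\<dots> = {1..n}" unfolding set_u by auto
  finally have "xs @ ys \<in> words i n"
    using dist filt xy assms by (simp add: words_def del: upt_Suc)
  with xy show "u \<in> (\<Union>w\<in>words i n. set (insertions (Suc n) w))"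
    by (auto simp: set_insertions)
next
  fix u assume "u \<in> (\<Union>w\<in>words i n. set (insertions (Suc n) w))"
  then obtain xs ys where w: "xs @ ys \<in> words i n" and u: "u = xs @ Suc n # ys"
    by (auto simp: set_insertions)
  have st: "set (xs @ ys) = {1..n}" using w by (simp add: words_def)
  then have "Suc n \<notin> set (xs @ ys)" by simp
  moreover have "set u = insert (Suc n) (set (xs @ ys))" by (simp add: u)
  then have "set u = {1..Suc n}" unfolding st by (simp add: atLeastAtMostSuc_conv)
  ultimately show "u \<in> words i (Suc n)" using w u assms by (simp add: words_def del: upt_Suc)
qed

lemma adj_count_upt: "(\<And>x. \<not> P x (Suc x)) \<Longrightarrow> adj_count P [i..<j] = 0"
proof (induction "j - i" arbitrary: i)
  case (Suc k)
  then have "i < j" by simp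
  then show ?case using Suc.hyps(1)[of "Suc i"] Suc.hyps(2) Suc.prems
    by (cases "Suc i < j") (simp_all add: upt_conv_Cons)
qed simp

text \<open>The states for \<open>Suc n\<close> arise from those for \<open>n\<close> by applying
  \<open>children n\<close>, which commutes with the swap.\<close>

lemma swap_state_states_words:
  assumes "1 \<le> i" "i \<le> n"
  shows "image_mset swap_state (image_mset state (mset_set (words i n)))
    = image_mset state (mset_set (words i n))"
  using assms(2)
proof (induction n rule: dec_induct)
  case base
  \<comment> \<open>Consecutive integers ascend and differ in parity, so the only word has
    \<open>a = b = 0\<close>, a state fixed by the swap.\<close>
  have "adj_count (\<lambda>x y. y < x \<and> odd x) [1..<Suc i] = 0"
    "adj_count (\<lambda>x y. odd x \<and> odd y) [1..<Suc i] = 0"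
    by (rule adj_count_upt; simp)+
  then show ?case by (simp add: words_self state_def del: upt_Suc)
next
  case (step n)
  define M where "M = image_mset state (mset_set (words i n))"
  have mem: "distinct w" "set w = {1..n}" if "w \<in> words i n" for w
    using that by (auto simp: words_def)
  have "image_mset state (mset_set (words i (Suc n)))
      = (\<Sum>w\<in>words i n. image_mset state (mset (insertions (Suc n) w)))"
    unfolding words_Suc[OF step.hyps(1)]
    using mem(2)
    by (subst mset_set_UN_insertions)
      (simp_all add: finite_words sum_comp_morphism[of "image_mset state", symmetric] o_def)
  also have "\<dots> = (\<Sum>w\<in>words i n. children n (state w))"
    using mem assms step.hyps by (intro sum.cong refl states_insertions) auto
  also have "\<dots> = (\<Sum>s\<in>#M. children n s)"
    by (simp add: M_def sum_unfold_sum_mset image_mset.compositionality o_def)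
  finally have eq: "image_mset state (mset_set (words i (Suc n))) = (\<Sum>s\<in>#M. children n s)" .
  have "image_mset swap_state (\<Sum>s\<in>#M. children n s)
      = (\<Sum>s\<in>#M. image_mset swap_state (children n s))"
    by (induction M) auto
  also have "\<dots> = (\<Sum>s\<in>#image_mset swap_state M. children n s)"
    by (simp add: children_swap_state image_mset.compositionality o_def)
  also have "image_mset swap_state M = M" using step.IH by (simp add: M_def)
  finally show ?case unfolding eq .
qed

section \<open>Translation between permutations and words\<close>

definition word_of :: "nat \<Rightarrow> (nat \<Rightarrow> 'a) \<Rightarrow> 'a list" where
  "word_of n p = map p [1..<Suc n]"

text \<open>Injectivity suffices, since both sets have \<open>fact n\<close> elements.\<close>

lemma bij_betw_word_of:
  "bij_betw (word_of n) {p. p permutes {1..n}} (permutations_of_set {1..n})"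
proof -
  let ?S = "{p. p permutes {1..n}}" and ?T = "permutations_of_set {1..n}"
  have inj: "inj_on (word_of n) ?S"
  proof (rule inj_onI)
    fix p q assume pq: "p \<in> ?S" "q \<in> ?S" "word_of n p = word_of n q"
    then have "p i = q i" if "i \<in> {1..n}" for i
      using that by (auto simp: word_of_def simp del: upt_Suc)
    then show "p = q" using pq by (metis ext mem_Collect_eq permutes_not_in)
  qed
  have "word_of n ` ?S \<subseteq> ?T"
  proof (intro image_subsetI)
    fix p assume "p \<in> ?S"
    then have "p permutes {1..n}" by simp
    then have "distinct (word_of n p)" "set (word_of n p) = {1..n}"
      by (auto simp: word_of_def distinct_map permutes_inj_on atLeastLessThanSuc_atLeastAtMost
          permutes_image simp del: upt_Suc)
    then show "word_of n p \<in> ?T" by (simp add: permutations_of_set_def)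
  qed
  moreover have "card (word_of n ` ?S) = card ?T"
  proof -
    have "card ?S = fact n" by (rule card_permutations) simp_all
    then show ?thesis unfolding card_image[OF inj] by simp
  qed
  ultimately have "word_of n ` ?S = ?T"
    by (intro card_subset_eq finite_permutations_of_set)
  with inj show ?thesis by (simp add: bij_betw_def)
qed

lemma adj_count_word_of: "adj_count P (word_of n p) = card {i \<in> {1..n - 1}. P (p i) (p (i + 1))}"
proof -
  have "adj_count P (map p [m..<Suc n]) = card {i \<in> {m..<n}. P (p i) (p (i + 1))}" if "m \<le> n" for m
    using that
  proof (induction m rule: inc_induct)
    case (step m)
    have "{i \<in> {m..<n}. P (p i) (p (i + 1))} =
      (if P (p m) (p (m + 1)) then insert m else id) {i \<in> {Suc m..<n}. P (p i) (p (i + 1))}"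
      using step.hyps by (auto simp: Suc_le_eq le_less)
    moreover have "map p [m..<Suc n] = p m # p (Suc m) # map p [Suc (Suc m)..<Suc n]"
      using step.hyps by (simp add: upt_conv_Cons del: upt_Suc)
    moreover have "map p [Suc m..<Suc n] = p (Suc m) # map p [Suc (Suc m)..<Suc n]"
      using step.hyps by (simp add: upt_conv_Cons del: upt_Suc)
    ultimately show ?case using step.IH by (auto simp del: upt_Suc)
  qed simp
  \<comment> \<open>For \<open>n = 0\<close> the start \<open>m = 1\<close> is out of range, but
    both sides are then zero.\<close>
  from this[of 1] show ?thesis
    by (cases n) (auto simp: word_of_def atLeastLessThanSuc_atLeastAtMost simp del: upt_Suc)
qed

text \<open>\<open>?Q\<close> lists the positions of \<open>1, ..., i\<close> by value,
  \<open>?F\<close> lists the same positions from left to right. As \<open>?F\<close> is sorted,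
  \<open>?Q\<close> is sorted iff the lists agree, and the injective \<open>p\<close> turns this
  into equality of words.\<close>

lemma strict_mono_on_inv_iff:
  assumes p: "p permutes {1..n}" and i: "i \<le> n"
  shows "strict_mono_on {1..i} (inv p) \<longleftrightarrow> filter (\<lambda>x. x \<le> i) (word_of n p) = [1..<Suc i]"
proof -
  let ?F = "filter (\<lambda>j. p j \<le> i) [1..<Suc n]" and ?Q = "map (inv p) [1..<Suc i]"
  have Q: "map p ?Q = [1..<Suc i]"
    using p by (simp add: o_def permutes_inverses del: upt_Suc)
  have F: "filter (\<lambda>x. x \<le> i) (word_of n p) = map p ?F"
    by (simp add: word_of_def filter_map o_def del: upt_Suc)
  have srtF: "sorted_wrt (<) ?F" by (intro sorted_wrt_filter sorted_wrt_upt)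
  have set_eq: "set ?Q = set ?F"
  proof -
    have "inv p ` {1..i} = {j \<in> {1..n}. p j \<le> i}"
    proof (intro equalityI subsetI)
      fix j assume "j \<in> inv p ` {1..i}"
      then obtain k where k: "k \<in> {1..i}" "j = inv p k" by auto
      then have "inv p k \<in> {1..n}" using i permutes_in_image[OF permutes_inv[OF p], of k] by simp
      with k show "j \<in> {j \<in> {1..n}. p j \<le> i}" using permutes_inverses(1)[OF p] by simp
    next
      fix j assume "j \<in> {j \<in> {1..n}. p j \<le> i}"
      then have "p j \<in> {1..i}" using permutes_in_image[OF p, of j] by simp
      then show "j \<in> inv p ` {1..i}" using permutes_inverses(2)[OF p] by (metis image_eqI)
    qed
    then show ?thesis by (simp add: atLeastLessThanSuc_atLeastAtMost del: upt_Suc)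
  qed
  have "strict_mono_on {1..i} (inv p) \<longleftrightarrow> sorted_wrt (<) ?Q"
  proof
    assume "sorted_wrt (<) ?Q"
    then have less: "inv p (Suc k) < inv p (Suc l)" if "k < l" "l < i" for k l
      using that by (simp add: sorted_wrt_iff_nth_less del: upt_Suc)
    show "strict_mono_on {1..i} (inv p)"
    proof (rule strict_mono_onI)
      fix r s assume "r \<in> {1..i}" "s \<in> {1..i}" "r < s"
      then show "inv p r < inv p s" using less[of "r - 1" "s - 1"] by simp
    qed
  qed (simp add: strict_mono_on_def sorted_wrt_iff_nth_less del: upt_Suc)
  also have "\<dots> \<longleftrightarrow> ?Q = ?F"
    using srtF set_eq by (metis strict_sorted_equal)
  also have "\<dots> \<longleftrightarrow> map p ?Q = map p ?F"
    using permutes_inj[OF p] by (simp add: inj_map_eq_map del: map_map upt_Suc)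
  finally show ?thesis unfolding Q F by auto
qed

lemma S17_ge_iff:
  assumes p: "p permutes {1..n}" and i: "1 \<le> i" "i \<le> n"
  shows "i \<le> S17 n p \<longleftrightarrow> word_of n p \<in> words i n"
proof -
  let ?A = "{i \<in> {1..n}. strict_mono_on {1..i} (inv p)}"
  have "1 \<in> ?A" using i by (auto simp: strict_mono_on_def)
  then have ne: "?A \<noteq> {}" by blast
  have "i \<le> S17 n p \<longleftrightarrow> (\<exists>j\<in>?A. i \<le> j)"
    unfolding S17_def using ne by (subst Max_ge_iff) auto
  \<comment> \<open>The set \<open>?A\<close> is closed downwards within
    \<open>{1..n}\<close>.\<close>
  also have "\<dots> \<longleftrightarrow> strict_mono_on {1..i} (inv p)"
    using i by (auto intro: monotone_on_subset)
  also have "\<dots> \<longleftrightarrow> word_of n p \<in> words i n"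
    using strict_mono_on_inv_iff[OF p i(2)] bij_betwE[OF bij_betw_word_of, of n] p
    by (auto simp: words_def permutations_of_set_def)
  finally show ?thesis .
qed

lemma S17_bounds:
  assumes "n \<ge> 1"
  shows "1 \<le> S17 n p" "S17 n p \<le> n"
proof -
  let ?A = "{i \<in> {1..n}. strict_mono_on {1..i} (inv p)}"
  have "1 \<in> ?A" using assms by (auto simp: strict_mono_on_def)
  then have "Max ?A \<in> ?A" by (intro Max_in) auto
  then show "1 \<le> S17 n p" "S17 n p \<le> n" by (auto simp: S17_def)
qed

section \<open>Exchanging the two statistics\<close>

lemma card_S17_ge:
  fixes a b :: int
  assumes n: "n \<ge> 1"
  shows "card {p. p permutes {1..n} \<and> int (S10 n p) = a \<and> int (S12 n p) = b \<and> i \<le> S17 n p} =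
         card {p. p permutes {1..n} \<and> int (S12 n p) = a \<and> int (S10 n p) = b \<and> i \<le> S17 n p}"
proof -
  have main: "card {p. p permutes {1..n} \<and> int (S10 n p) = a \<and> int (S12 n p) = b \<and> i \<le> S17 n p} =
         card {p. p permutes {1..n} \<and> int (S12 n p) = a \<and> int (S10 n p) = b \<and> i \<le> S17 n p}"
    if i: "1 \<le> i" "i \<le> n" for i
  proof -
    define M where "M = image_mset state (mset_set (words i n))"
    \<comment> \<open>Permutations with \<open>i \<le> S17 n p\<close> are counted through their
      states, so the invariance of \<open>M\<close> under the swap applies.\<close>
    have cnt: "card {p. p permutes {1..n} \<and> Q (state (word_of n p)) \<and> i \<le> S17 n p}
        = size (filter_mset Q M)" for Q
    proof -
      have "bij_betw (word_of n) {p. p permutes {1..n} \<and> Q (state (word_of n p)) \<and> i \<le> S17 n p}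
          {w \<in> words i n. Q (state w)}"
      proof (rule bij_betw_subset[OF bij_betw_word_of])
        have "words i n \<subseteq> word_of n ` {p. p permutes {1..n}}"
          unfolding bij_betw_imp_surj_on[OF bij_betw_word_of] 
          by (auto simp: words_def permutations_of_set_def)
        then show "word_of n ` {p. p permutes {1..n} \<and> Q (state (word_of n p)) \<and> i \<le> S17 n p}
          = {w \<in> words i n. Q (state w)}"
          using S17_ge_iff i by auto
      qed auto
      then show ?thesis
        by (simp add: bij_betw_same_card M_def filter_mset_image_mset finite_words)
    qed
    let ?Q = "\<lambda>(a', b', c, e). a' = a \<and> b' = b"
    have "card {p. p permutes {1..n} \<and> int (S10 n p) = a \<and> int (S12 n p) = b \<and> i \<le> S17 n p}
        = size (filter_mset ?Q M)"
      unfolding cnt[symmetric] by (simp add: state_def adj_count_word_of S10_def S12_def)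
    also have "\<dots> = size (filter_mset ?Q (image_mset swap_state M))"
      using swap_state_states_words[OF i] by (simp add: M_def)
    also have "\<dots> = size (filter_mset (\<lambda>s. ?Q (swap_state s)) M)"
      by (simp add: filter_mset_image_mset)
    also have "\<dots> = card {p. p permutes {1..n} \<and> int (S12 n p) = a \<and> int (S10 n p) = b \<and> i \<le> S17 n p}"
      unfolding cnt[symmetric] by (simp add: state_def adj_count_word_of S10_def S12_def)
    finally show ?thesis .
  qed
  \<comment> \<open>Since \<open>S17\<close> lies between 1 and \<open>n\<close>, the bound
    \<open>i = 0\<close> is equivalent to \<open>i = 1\<close>, and \<open>n < i\<close> gives empty
    sets.\<close>
  consider "i = 0" | "1 \<le> i" "i \<le> n" | "n < i" by linarith
  then show ?thesis
  proof cases
    case 1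
    then show ?thesis using main[of 1] S17_bounds(1)[OF n] n by simp
  next
    case 3
    then have "\<not> i \<le> S17 n p" for p using S17_bounds(2)[OF n, of p] by simp
    then show ?thesis by simp
  qed (rule main)
qed

theorem corollary1p4:
  fixes n :: nat and a b c :: int
  assumes "n \<ge> 1"
  shows "card {p. p permutes {1..n} \<and> (int (S10 n p), int (S12 n p), int (S17 n p)) = (a, b, c)} =
         card {p. p permutes {1..n} \<and> (int (S12 n p), int (S10 n p), int (S17 n p)) = (a, b, c)}"
proof (cases "c < 0")
  case False
  then obtain k where k: "c = int k" by (metis nonneg_int_cases not_less)
  \<comment> \<open>The second set is contained in the first, so the subtraction of naturals does
    not truncate.\<close>
  have diff: "card {p. p permutes {1..n} \<and> Q p \<and> S17 n p = k} =
      card {p. p permutes {1..n} \<and> Q p \<and> k \<le> S17 n p} -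
      card {p. p permutes {1..n} \<and> Q p \<and> Suc k \<le> S17 n p}" for Q
  proof -
    have "{p. p permutes {1..n} \<and> Q p \<and> S17 n p = k} =
      {p. p permutes {1..n} \<and> Q p \<and> k \<le> S17 n p} -
      {p. p permutes {1..n} \<and> Q p \<and> Suc k \<le> S17 n p}" by auto
    moreover have "finite {p. p permutes {1..n} \<and> Q p \<and> Suc k \<le> S17 n p}"
      by (rule finite_subset[OF _ finite_permutations[of "{1..n}"]]) auto
    ultimately show ?thesis by (simp add: card_Diff_subset Collect_mono_iff del: One_nat_def)
  qed
  show ?thesis
    using diff[of "\<lambda>p. int (S10 n p) = a \<and> int (S12 n p) = b"]
      diff[of "\<lambda>p. int (S12 n p) = a \<and> int (S10 n p) = b"]
      card_S17_ge[OF assms, of a b k] card_S17_ge[OF assms, of a b "Suc k"]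
    by (simp add: k)
qed auto

end
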